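(* Fix an integer $d\ge2$ and a field $\mathbb{F}\in\{\mathbb{R},\mathbb{C}\}$. Over the class of all laws of i.i.d. sequences $X_1,X_2,\ldots$ of random real $d\times d$ matrices satisfying only $\mathbb{E}\|X_1\|_2<\infty$, diagonalizability of $\mathbb{E}X_1$ over $\mathbb{F}$ is not eventually almost surely predictable. That is, there is no sequence of Borel maps $\Phi_N:(\mathbb{R}^{d\times d})^N\to\{0,1\}$, $N\ge1$, such that for every law in this class, $$\mathbb{P}\left(\Phi_N(X_1,\ldots,X_N)=\mathbf{1}\{\mathbb{E}X_1\in\mathcal{D}_{\mathbb{F},d}\}\text{ for all sufficiently large }N\right)=1.$$
   Context: For $\mathbb{F}\in\{\mathbb{R},\mathbb{C}\}$, $\mathcal{D}_{\mathbb{F},d}\subseteq\mathbb{R}^{d\times d}$ denotes the set of real $d\times d$ matrices that are diagonalizable over $\mathbb{F}$, i.e. similar over $\mathbb{F}$ to a diagonal matrix with entries in $\mathbb{F}$. The norm $\|\cdot\|_2$ is the Euclidean norm on $\mathbb{R}^{d\times d}\cong\mathbb{R}^{d^2}$ (the integrability condition does not depend on the choice of norm). $\mathbb{E}X_1$ is the entrywise mean. *)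

theory Defs
  imports "HOL-Probability.Probability"
begin

definition diagonal_matrix :: "'a::zero ^'n^'n \<Rightarrow> bool" where
  "diagonal_matrix A \<longleftrightarrow> (\<forall>i j. i \<noteq> j \<longrightarrow> A $ i $ j = 0)"

definition similar_matrices :: "'a::field ^'n^'n \<Rightarrow> 'a ^'n^'n \<Rightarrow> bool" where
  "similar_matrices A B \<longleftrightarrow> (\<exists>P. invertible P \<and> A = P ** B ** matrix_inv P)"

text \<open>The field is passed as a type; it is only used at types \<open>real\<close> and \<open>complex\<close>.\<close>

definition diagonalizable_over :: "'k::real_field itself \<Rightarrow> (real ^'n^'n) set" where
  "diagonalizable_over _ =
     {A. \<exists>D :: 'k ^'n^'n. diagonal_matrix D \<and> similar_matrices (map_matrix of_real A) D}"

text \<open>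
  A sequence is represented by its law \<open>M\<close> on the space of sequences, and the random variables
  are the coordinate projections. Sequences are indexed from \<open>0\<close>, so \<open>X\<^sub>1, \<dots>, X\<^sub>N\<close> are the
  coordinates \<open>0, \<dots>, N - 1\<close>.
\<close>

definition iid_laws :: "(nat \<Rightarrow> 'x::topological_space) measure set" where
  "iid_laws = {M. prob_space M \<and> sets M = sets (PiM UNIV (\<lambda>_. borel)) \<and>
     prob_space.indep_vars M (\<lambda>_. borel) (\<lambda>i \<omega>. \<omega> i) UNIV \<and>
     (\<forall>i. distr M borel (\<lambda>\<omega>. \<omega> i) = distr M borel (\<lambda>\<omega>. \<omega> 0))}"

text \<open>The norm on \<open>real ^'n^'n\<close> is the Euclidean norm of the vector of all entries.\<close>

definition integrable_iid_laws :: "(nat \<Rightarrow> real ^'n^'n) measure set" where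
  "integrable_iid_laws = {M \<in> iid_laws. integrable M (\<lambda>\<omega>. norm (\<omega> 0))}"

definition mean_matrix :: "(nat \<Rightarrow> real ^'n^'n) measure \<Rightarrow> real ^'n^'n" where
  "mean_matrix M = (\<chi> i j. \<integral>\<omega>. \<omega> 0 $ i $ j \<partial>M)"

text \<open>
  The property \<open>Q\<close> is a property of the law. The domain of \<open>\<Phi> N\<close> is the \<open>N\<close>-fold product space,
  whose product sigma-algebra is the Borel one for second countable \<open>'x\<close>.
\<close>

definition eventually_as_predictable ::
    "(nat \<Rightarrow> 'x::topological_space) measure set \<Rightarrow> ((nat \<Rightarrow> 'x) measure \<Rightarrow> bool) \<Rightarrow> bool" where
  "eventually_as_predictable L Q \<longleftrightarrow>
     (\<exists>\<Phi> :: nat \<Rightarrow> (nat \<Rightarrow> 'x) \<Rightarrow> nat.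
        (\<forall>N\<ge>1. \<Phi> N \<in> measurable (PiM {..<N} (\<lambda>_. borel)) (count_space {0, 1})) \<and>
        (\<forall>M\<in>L. \<P>(\<omega> in M. \<forall>\<^sub>F N in sequentially. \<Phi> N (restrict \<omega> {..<N}) = of_bool (Q M)) = 1))"

end

theory Submission
  imports Defs
begin

text \<open>
  The mean of an integrable law is unstable: an amount \<open>\<epsilon>\<close> of mean can be carried by a value of size
  \<open>h\<close> taken with probability \<open>\<epsilon> / h\<close>, and for large \<open>h\<close> a sample of moderate length does not see it.
  The proof turns this into a Baire category argument on a closed family of laws.

  On \<open>(0, 1)\<close> with the uniform measure, let \<open>T q u\<close> be the sum of those numbers \<open>k + 1\<close> for which
  \<open>u < q k / (k + 1)\<close>, where \<open>q\<close> ranges over the nonnegative sequences of total sum at most \<open>1\<close>. Then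
  \<open>T q\<close> has expectation \<open>\<Sum>k. q k\<close> (lemma \<open>expectation_spike_sum\<close>). Give the sequences the topology of
  pointwise convergence; the family is closed in a complete metric space. Two facts pull in opposite
  directions.

  \<^item> The samples depend continuously on \<open>q\<close>: if \<open>r j\<close> tends to \<open>q\<close> pointwise, then for almost every
    \<open>u\<close> the value \<open>T (r j) u\<close> equals \<open>T q u\<close> for all large \<open>j\<close> (lemma \<open>spike_sum_eventually_const\<close>).
    The reason is that \<open>q k / (k + 1) \<le> 1 / (k + 1)\<close>, so only finitely many \<open>k\<close> matter at a given \<open>u\<close>,
    uniformly in \<open>q\<close>.

  \<^item> The mean does not: mass may escape along \<open>k\<close>, so the sequences of sum equal to \<open>1\<close> and those of
    smaller sum are both dense (lemma \<open>subprob_sequences_dense_both\<close>).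

  Suppose that some predictor detects from i.i.d. samples of \<open>T q\<close> whether the mean differs from \<open>1\<close>.
  For an answer \<open>b\<close> and a time \<open>N\<close>, consider the set of those \<open>q\<close> for which, with probability at
  least \<open>1/2\<close>, the predictor answers \<open>b\<close> at every time after \<open>N\<close>. By continuity of the samples these
  sets are closed, and they cover the family because the predictor succeeds. By Baire's theorem one
  of them contains a nonempty relatively open set, which by density contains a \<open>q\<close> whose correct
  answer is \<open>\<not> b\<close>. There the predictor is almost surely eventually right and with probability at least
  \<open>1/2\<close> eventually wrong, a contradiction.

  For matrices, let \<open>E a b\<close> be the matrix unit with \<open>1\<close> at row \<open>a\<close> and column \<open>b\<close>, where \<open>a \<noteq> b\<close>, and
  sample \<open>E a b + (1 - T q) E b b\<close>. The mean is \<open>E a b + t E b b\<close> with \<open>t = 1 - (\<Sum>k. q k)\<close>. Over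
  \<open>\<real>\<close> and over \<open>\<complex>\<close> this is diagonalizable if \<open>t \<noteq> 0\<close>; for \<open>t = 0\<close> it is nilpotent and nonzero, hence
  not diagonalizable.
\<close>

section \<open>Diagonalizability along a line through a nilpotent matrix\<close>

text \<open>The matrix \<open>E a b + t E b b\<close>, for \<open>a \<noteq> b\<close>.\<close>

definition corner_matrix :: "'n \<Rightarrow> 'n \<Rightarrow> 'k \<Rightarrow> 'k::field ^'n::finite^'n" where
  "corner_matrix a b t = (\<chi> i j. if j = b then (if i = a then 1 else if i = b then t else 0) else 0)"

lemma matrix_mult_corner:
  fixes A :: "'k::field ^'n::finite^'n"
  assumes "a \<noteq> b"
  shows "(A ** corner_matrix a b t) $ i $ j = (if j = b then A $ i $ a + A $ i $ b * t else 0)"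
proof -
  have "(A ** corner_matrix a b t) $ i $ b
      = (\<Sum>k\<in>UNIV. (if k = a then A $ i $ a else 0) + (if k = b then A $ i $ b * t else 0))"
    using assms by (auto simp: matrix_matrix_mult_def corner_matrix_def intro!: sum.cong)
  then show ?thesis
    by (auto simp: sum.distrib) (simp add: matrix_matrix_mult_def corner_matrix_def)
qed

lemma matrix_inv_inverse:
  fixes P :: "'k::semiring_1 ^'n::finite^'n"
  assumes "invertible P"
  shows "P ** matrix_inv P = mat 1" and "matrix_inv P ** P = mat 1"
  using someI_ex[OF assms[unfolded invertible_def]] unfolding matrix_inv_def by auto

text \<open>
  The eigenvalues are \<open>t\<close> and \<open>0\<close>. For \<open>t \<noteq> 0\<close> the matrix is conjugated to \<open>t E b b\<close> by the shear
  \<open>1 + E a b / t\<close>. For \<open>t = 0\<close> its square vanishes, while a diagonal matrix of square zero is zero.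
\<close>

lemma diagonalizable_corner_matrix_iff:
  fixes t :: real and a b :: "'n::finite"
  assumes ab: "a \<noteq> b"
  shows "corner_matrix a b t \<in> diagonalizable_over TYPE('k::real_field) \<longleftrightarrow> t \<noteq> 0"
proof -
  have map: "map_matrix of_real (corner_matrix a b t) = (corner_matrix a b (of_real t) :: 'k^'n^'n)"
    by (simp add: map_matrix_def corner_matrix_def vec_eq_iff)
  define C :: "'k^'n^'n" where "C = corner_matrix a b (of_real t)"
  have "\<exists>D. diagonal_matrix D \<and> similar_matrices C D" if "t \<noteq> 0"
  proof -
    define P :: "'k \<Rightarrow> 'k^'n^'n"
      where "P s = (\<chi> i j. if i = j then 1 else if i = a \<and> j = b then s else 0)" for s
    define D :: "'k^'n^'n" where "D = (\<chi> i j. if i = b \<and> j = b then of_real t else 0)"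
    have P_row: "P s $ i $ k = (if k = i then 1 else 0) + (if k = b then if i = a then s else 0 else 0)"
      for s i k using ab by (auto simp: P_def)
    have P_mult: "(P s ** A) $ i $ j = A $ i $ j + (if i = a then s * A $ b $ j else 0)" for s A i j
    proof -
      have "(P s ** A) $ i $ j = (\<Sum>k\<in>UNIV. (if k = i then A $ i $ j else 0)
          + (if k = b then if i = a then s * A $ b $ j else 0 else 0))"
        unfolding matrix_matrix_mult_def vec_lambda_beta using ab
        by (intro sum.cong) (auto simp: P_row algebra_simps)
      then show ?thesis by (simp add: sum.distrib)
    qed
    have inv: "P s ** P (- s) = mat 1" for s
      unfolding vec_eq_iff P_mult using ab by (auto simp: P_def mat_def)
    have inv1: "P (1 / of_real t) ** P (- (1 / of_real t)) = mat 1"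
      and inv2: "P (- (1 / of_real t)) ** P (1 / of_real t) = mat 1"
      using inv[of "1 / of_real t"] inv[of "- (1 / of_real t)"] by simp_all
    have "invertible (P (1 / of_real t))"
      using inv1 inv2 by (auto simp: invertible_def)
    moreover have "C = P (1 / of_real t) ** D ** matrix_inv (P (1 / of_real t))"
    proof -
      have "C ** P (1 / of_real t) = P (1 / of_real t) ** D"
      proof -
        have "(C ** P (1 / of_real t)) $ i $ j = (P (1 / of_real t) ** D) $ i $ j" for i j
        proof -
          have "(C ** P (1 / of_real t)) $ i $ j = C $ i $ b * P (1 / of_real t) $ b $ j"
          proof -
            have "(C ** P (1 / of_real t)) $ i $ j
                = (\<Sum>k\<in>UNIV. if k = b then C $ i $ b * P (1 / of_real t) $ b $ j else 0)"
              unfolding matrix_matrix_mult_def vec_lambda_beta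
              by (intro sum.cong) (auto simp: C_def corner_matrix_def)
            then show ?thesis by simp
          qed
          then show ?thesis
            unfolding P_mult using ab that by (auto simp: C_def corner_matrix_def P_def D_def)
        qed
        then show ?thesis by (simp add: vec_eq_iff)
      qed
      then have "P (1 / of_real t) ** D ** matrix_inv (P (1 / of_real t))
          = C ** (P (1 / of_real t) ** matrix_inv (P (1 / of_real t)))"
        by (simp add: matrix_mul_assoc)
      then show ?thesis
        using \<open>invertible (P (1 / of_real t))\<close> by (simp add: matrix_inv_inverse)
    qed
    moreover have "diagonal_matrix D" by (simp add: diagonal_matrix_def D_def)
    ultimately show ?thesis unfolding similar_matrices_def by blast
  qed
  moreover have False if D: "diagonal_matrix D" "similar_matrices C D" and "t = 0" for D
  proof -
    obtain P where P: "invertible P" "C = P ** D ** matrix_inv P"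
      using D unfolding similar_matrices_def by blast
    have sq: "C ** C = 0"
      using ab \<open>t = 0\<close> unfolding C_def vec_eq_iff matrix_mult_corner[OF ab]
      by (auto simp: corner_matrix_def)
    have "P ** (D ** D) ** matrix_inv P = P ** D ** (matrix_inv P ** P) ** D ** matrix_inv P"
      using P(1) by (simp add: matrix_inv_inverse matrix_mul_assoc)
    also have "\<dots> = 0" using sq P(2) by (simp add: matrix_mul_assoc)
    finally have "matrix_inv P ** (P ** (D ** D) ** matrix_inv P) ** P = 0" by simp
    moreover have "matrix_inv P ** (P ** (D ** D) ** matrix_inv P) ** P
        = (matrix_inv P ** P) ** (D ** D) ** (matrix_inv P ** P)"
      by (simp add: matrix_mul_assoc)
    ultimately have DD: "D ** D = 0" using P(1) by (simp add: matrix_inv_inverse)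
    have "D $ i $ i = 0" for i
    proof -
      have "(D ** D) $ i $ i = (\<Sum>k\<in>UNIV. if k = i then D $ i $ i * D $ i $ i else 0)"
        unfolding matrix_matrix_mult_def vec_lambda_beta using D(1)
        by (intro sum.cong) (auto simp: diagonal_matrix_def)
      then show ?thesis using DD by simp
    qed
    then have "D = 0" using D(1) by (auto simp: vec_eq_iff diagonal_matrix_def) metis
    then have "C = 0" using P(2) by simp
    then have "C $ a $ b = 0" by simp
    then show False by (simp add: C_def corner_matrix_def)
  qed
  ultimately show ?thesis
    unfolding diagonalizable_over_def mem_Collect_eq map C_def[symmetric] by blast
qed

section \<open>Laws of i.i.d. sequences\<close>

lemma iid_laws_distr_PiM:
  fixes Y :: "'a \<Rightarrow> 'x::topological_space"
  assumes "prob_space B" and Y [measurable]: "Y \<in> borel_measurable B"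
  defines "M \<equiv> distr (\<Pi>\<^sub>M i\<in>(UNIV :: nat set). B) (\<Pi>\<^sub>M i\<in>UNIV. borel) (\<lambda>\<omega> i. Y (\<omega> i))"
  shows "M \<in> iid_laws" and "distr M borel (\<lambda>\<omega>. \<omega> i) = distr B borel Y"
proof -
  interpret B: prob_space B by fact
  interpret product_prob_space "\<lambda>_. B" "UNIV :: nat set" ..
  let ?W = "\<Pi>\<^sub>M i\<in>(UNIV :: nat set). B"
  have map_meas [measurable]: "(\<lambda>\<omega> i. Y (\<omega> i)) \<in> measurable ?W (\<Pi>\<^sub>M i\<in>(UNIV :: nat set). borel)"
    by (rule measurable_PiM_single') auto
  interpret M: prob_space M
    unfolding M_def by (rule P.prob_space_distr) (rule map_meas)
  have coord: "distr M borel (\<lambda>\<omega>. \<omega> i) = distr B borel Y" for i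
  proof -
    have "distr M borel (\<lambda>\<omega>. \<omega> i) = distr ?W borel (\<lambda>\<omega>. Y (\<omega> i))"
      unfolding M_def by (subst distr_distr) (auto simp: comp_def)
    also have "\<dots> = distr (distr ?W B (\<lambda>\<omega>. \<omega> i)) borel Y"
      by (subst distr_distr) (auto simp: comp_def)
    also have "distr ?W B (\<lambda>\<omega>. \<omega> i) = B" by (rule PiM_component) simp
    finally show ?thesis .
  qed
  show "distr M borel (\<lambda>\<omega>. \<omega> i) = distr B borel Y" by (rule coord)
  have sets_M: "sets M = sets (\<Pi>\<^sub>M i\<in>(UNIV :: nat set). borel)" by (simp add: M_def)
  have "P.indep_vars (\<lambda>_. B) (\<lambda>i \<omega>. \<omega> i) UNIV"
    using PiM_component by (subst P.indep_vars_iff_distr_eq_PiM) (simp_all add: restrict_UNIV)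
  then have "P.indep_vars (\<lambda>_. borel) (\<lambda>i \<omega>. Y (\<omega> i)) UNIV"
    by (rule P.indep_vars_compose2) simp
  then have "M = (\<Pi>\<^sub>M i\<in>UNIV. distr ?W borel (\<lambda>\<omega>. Y (\<omega> i)))"
    by (subst (asm) P.indep_vars_iff_distr_eq_PiM) (simp_all add: M_def restrict_UNIV)
  moreover have "distr M (\<Pi>\<^sub>M i\<in>UNIV. borel) (\<lambda>\<omega>. \<omega>) = M"
    by (rule distr_id2) (simp add: sets_M)
  moreover have "distr ?W borel (\<lambda>\<omega>. Y (\<omega> i)) = distr M borel (\<lambda>\<omega>. \<omega> i)" for i
    unfolding M_def by (subst distr_distr) (auto simp: comp_def)
  ultimately have "M.indep_vars (\<lambda>_. borel) (\<lambda>i \<omega>. \<omega> i) UNIV"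
    by (subst M.indep_vars_iff_distr_eq_PiM) (simp_all add: measurable_cong_sets[OF sets_M refl] restrict_UNIV)
  then show "M \<in> iid_laws"
    unfolding iid_laws_def using M.prob_space_axioms sets_M coord by auto
qed

section \<open>A family of samples that is continuous while its mean is not\<close>

definition subprob_sequences :: "(nat \<Rightarrow> real) set" where
  "subprob_sequences = {q. (\<forall>k. 0 \<le> q k) \<and> (\<forall>n. (\<Sum>k<n. q k) \<le> 1)}"

text \<open>
  All spikes are driven by the same \<open>u\<close>. The number \<open>q k\<close> is the contribution of spike \<open>k\<close> to the mean
  (height \<open>k + 1\<close> times length \<open>q k / (k + 1)\<close>), not its probability; in these coordinates the
  parameter set is defined by conditions on finitely many coordinates at a time, hence closed.
  For \<open>u > 0\<close> the series has finitely many nonzero terms.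
\<close>

definition spike_sum :: "(nat \<Rightarrow> real) \<Rightarrow> real \<Rightarrow> real" where
  "spike_sum q u = (\<Sum>k. real (Suc k) * of_bool (u < q k / real (Suc k)))"

abbreviation unit_uniform :: "real measure" where
  "unit_uniform \<equiv> uniform_measure lborel {0<..<1}"

lemma subprob_sequences_le_1: "q \<in> subprob_sequences \<Longrightarrow> q k \<le> 1"
proof -
  assume q: "q \<in> subprob_sequences"
  have "q k \<le> (\<Sum>k<Suc k. q k)"
    using q by (intro member_le_sum) (auto simp: subprob_sequences_def)
  also have "\<dots> \<le> 1" using q unfolding subprob_sequences_def by blast
  finally show ?thesis .
qed

lemma summable_subprob_sequences: "q \<in> subprob_sequences \<Longrightarrow> summable q"
  by (rule summableI_nonneg_bounded[of _ 1]) (auto simp: subprob_sequences_def)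

lemma closed_subprob_sequences: "closed subprob_sequences"
proof -
  have "subprob_sequences = (\<Inter>k. {q. 0 \<le> q k}) \<inter> (\<Inter>n. {q. (\<Sum>k<n. q k) \<le> 1})"
    by (auto simp: subprob_sequences_def)
  also have "closed \<dots>"
    by (intro closed_Int closed_INT ballI closed_Collect_le continuous_intros)
       (auto intro: continuous_on_product_coordinates)
  finally show ?thesis .
qed

lemma spike_vanishes:
  assumes "q \<in> subprob_sequences" "0 < u" "1 / u \<le> real k"
  shows "\<not> u < q k / real (Suc k)"
proof -
  have "q k / real (Suc k) \<le> 1 / real (Suc k)"
    using subprob_sequences_le_1[OF assms(1), of k] by (intro divide_right_mono) auto
  also have "1 / real (Suc k) \<le> u"
    using assms(2,3) by (simp add: field_simps)
  finally show ?thesis by simp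
qed

lemma summable_spikes:
  assumes "q \<in> subprob_sequences" "0 < u"
  shows "summable (\<lambda>k. real (Suc k) * of_bool (u < q k / real (Suc k)))"
proof (rule summable_finite[of "{..<nat \<lceil>1 / u\<rceil>}"])
  fix k assume "k \<notin> {..<nat \<lceil>1 / u\<rceil>}"
  then have "1 / u \<le> real k" by (metis lessThan_iff not_less real_nat_ceiling_ge of_nat_le_iff order_trans)
  then show "real (Suc k) * of_bool (u < q k / real (Suc k)) = 0"
    using spike_vanishes[OF assms] by simp
qed simp

text \<open>
  At \<open>u > 0\<close> only the spikes with \<open>k < 1 / u\<close> can contribute, for every parameter. Each of these finitely
  many is decided by a strict comparison of \<open>u\<close> with the limit \<open>q k / (k + 1)\<close>, which persists under
  small perturbation since \<open>u\<close> is not one of the thresholds.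
\<close>

lemma spike_sum_eventually_const:
  assumes q: "q \<in> subprob_sequences" "\<And>j. r j \<in> subprob_sequences"
    and lim: "\<And>k. (\<lambda>j. r j k) \<longlonglongrightarrow> q k"
    and u: "0 < u" "\<And>k. u \<noteq> q k / real (Suc k)"
  shows "\<forall>\<^sub>F j in sequentially. spike_sum (r j) u = spike_sum q u"
proof -
  have "\<forall>\<^sub>F j in sequentially. (u < r j k / real (Suc k)) = (u < q k / real (Suc k))" for k
  proof -
    have L: "(\<lambda>j. r j k / real (Suc k)) \<longlonglongrightarrow> q k / real (Suc k)"
      by (intro tendsto_divide lim tendsto_const) simp
    show ?thesis
    proof (cases "u < q k / real (Suc k)")
      case True
      then show ?thesis using order_tendstoD(1)[OF L] by simp
    next
      case False
      then have "q k / real (Suc k) < u" using u(2)[of k] by simp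
      from order_tendstoD(2)[OF L this] show ?thesis
        by eventually_elim (use False in auto)
    qed
  qed
  then have "\<forall>\<^sub>F j in sequentially. \<forall>k\<in>{..<nat \<lceil>1 / u\<rceil>}.
      (u < r j k / real (Suc k)) = (u < q k / real (Suc k))"
    by (intro eventually_ball_finite) auto
  then show ?thesis
  proof eventually_elim
    case (elim j)
    have "(u < r j k / real (Suc k)) = (u < q k / real (Suc k))" for k
    proof (cases "k < nat \<lceil>1 / u\<rceil>")
      case True
      then show ?thesis using elim by blast
    next
      case False
      then have "1 / u \<le> real k" by (metis lessThan_iff not_less real_nat_ceiling_ge of_nat_le_iff order_trans)
      then show ?thesis
        using spike_vanishes[OF q(1) u(1)] spike_vanishes[OF q(2) u(1)] by blast
    qed
    then show ?case unfolding spike_sum_def by presburger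
  qed
qed

lemma borel_measurable_spike_sum [measurable]: "spike_sum q \<in> borel_measurable borel"
  unfolding spike_sum_def by measurable

lemma AE_unit_uniform_pos: "AE u in unit_uniform. 0 < u"
  by (rule AE_uniform_measureI) auto

lemma prob_space_unit_uniform: "prob_space unit_uniform"
  by (rule prob_space_uniform_measure) auto

lemma AE_unit_uniform_neq: "AE u in unit_uniform. u \<noteq> (c::real)"
proof (rule AE_uniform_measureI)
  show "AE u in lborel. u \<in> {0<..<1} \<longrightarrow> u \<noteq> c"
    using AE_lborel_singleton[of c] by eventually_elim simp
qed simp

lemma expectation_spike_sum:
  assumes q: "q \<in> subprob_sequences"
  shows "integrable unit_uniform (spike_sum q)" "integral\<^sup>L unit_uniform (spike_sum q) = suminf q"
proof -
  let ?f = "\<lambda>k u. real (Suc k) * of_bool (u < q k / real (Suc k)) :: real"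
  have q0: "0 \<le> q k" for k using q by (simp add: subprob_sequences_def)
  have sq: "summable q" by (rule summable_subprob_sequences[OF q])
  have "(\<integral>\<^sup>+u. ennreal (?f k u) \<partial>unit_uniform) = ennreal (q k)" for k
  proof -
    let ?c = "q k / real (Suc k)"
    have c: "0 \<le> ?c" "?c \<le> 1"
      using q0[of k] subprob_sequences_le_1[OF q, of k] by (auto simp: field_simps)
    have "(\<integral>\<^sup>+u. ennreal (?f k u) \<partial>unit_uniform)
        = (\<integral>\<^sup>+u. ennreal (real (Suc k)) * indicator {..<?c} u \<partial>unit_uniform)"
      by (intro nn_integral_cong) (auto split: split_indicator)
    also have "\<dots> = ennreal (real (Suc k)) * emeasure unit_uniform {..<?c}"
      by (subst nn_integral_cmult_indicator) auto
    also have "emeasure unit_uniform {..<?c} = emeasure lborel ({0<..<1} \<inter> {..<?c})"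
      by (subst emeasure_uniform_measure) (simp_all add: divide_ennreal_def)
    also have "{0<..<1} \<inter> {..<?c} = {0<..<?c}" using c(2) by (auto simp del: of_nat_Suc divide_le_eq_1 divide_le_eq_1_pos)
    also have "ennreal (real (Suc k)) * emeasure lborel {0<..<?c} = ennreal (q k)"
      using c by (simp add: ennreal_mult[symmetric] del: of_nat_Suc)
    finally show ?thesis .
  qed
  then have "(\<integral>\<^sup>+u. (\<Sum>k. ennreal (?f k u)) \<partial>unit_uniform) = (\<Sum>k. ennreal (q k))"
    by (subst nn_integral_suminf) auto
  also have "\<dots> = ennreal (suminf q)"
    by (rule suminf_ennreal2[OF q0 sq])
  also have "(\<integral>\<^sup>+u. (\<Sum>k. ennreal (?f k u)) \<partial>unit_uniform) = (\<integral>\<^sup>+u. ennreal (spike_sum q u) \<partial>unit_uniform)"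
  proof (rule nn_integral_cong_AE)
    show "AE u in unit_uniform. (\<Sum>k. ennreal (?f k u)) = ennreal (spike_sum q u)"
      using AE_unit_uniform_pos
    proof eventually_elim
      case (elim u)
      then show ?case
        unfolding spike_sum_def by (intro suminf_ennreal2 summable_spikes[OF q]) auto
    qed
  qed
  finally have I: "(\<integral>\<^sup>+u. ennreal (spike_sum q u) \<partial>unit_uniform) = ennreal (suminf q)" .
  have "AE u in unit_uniform. 0 \<le> spike_sum q u"
    using AE_unit_uniform_pos
    unfolding spike_sum_def by eventually_elim (intro suminf_nonneg summable_spikes[OF q], auto)
  with I have "integrable unit_uniform (spike_sum q) \<and> integral\<^sup>L unit_uniform (spike_sum q) = suminf q"
    by (subst (asm) nn_integral_eq_integrable) (auto intro: suminf_nonneg sq q0)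
  then show "integrable unit_uniform (spike_sum q)" "integral\<^sup>L unit_uniform (spike_sum q) = suminf q"
    by auto
qed

section \<open>Baire category and density\<close>

lemma Baire_countable_closed_cover:
  fixes S :: "'a::complete_space set"
  assumes S: "closed S" "S \<noteq> {}" and "countable I"
    and closed: "\<And>i. i \<in> I \<Longrightarrow> closed (F i)" and cover: "S \<subseteq> (\<Union>i\<in>I. F i)"
  obtains i U where "i \<in> I" "open U" "S \<inter> U \<noteq> {}" "S \<inter> U \<subseteq> F i"
proof -
  have "completely_metrizable_space (top_of_set S)"
    using S(1) by (intro completely_metrizable_space_closedin completely_metrizable_space_euclidean) simp
  moreover have "countable ((\<lambda>i. S \<inter> F i) ` I)" using \<open>countable I\<close> by simp
  moreover have "(top_of_set S) interior_of (\<Union>((\<lambda>i. S \<inter> F i) ` I)) \<noteq> {}"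
  proof -
    have "\<Union>((\<lambda>i. S \<inter> F i) ` I) = topspace (top_of_set S)" using cover by auto
    then show ?thesis using S(2) by (metis interior_of_topspace topspace_euclidean_subtopology)
  qed
  ultimately obtain i where "i \<in> I"
    and "\<not> (closedin (top_of_set S) (S \<inter> F i) \<and> (top_of_set S) interior_of (S \<inter> F i) = {})"
    using Baire_category_alt[of "top_of_set S" "(\<lambda>i. S \<inter> F i) ` I"] by blast
  then obtain T where "openin (top_of_set S) T" "T \<noteq> {}" "T \<subseteq> S \<inter> F i"
    using closed by (metis closedin_closed_Int interior_of_subset openin_interior_of)
  then obtain U where "open U" "T = S \<inter> U" by (auto simp: openin_open)
  then show thesis using that \<open>i \<in> I\<close> \<open>T \<noteq> {}\<close> \<open>T \<subseteq> S \<inter> F i\<close> by blast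
qed

lemma tendsto_fun_iff_pointwise:
  fixes r :: "'j \<Rightarrow> 'a \<Rightarrow> 'b::topological_space"
  shows "(r \<longlongrightarrow> q) F \<longleftrightarrow> (\<forall>k. ((\<lambda>j. r j k) \<longlongrightarrow> q k) F)"
  unfolding limitin_canonical_iff[symmetric] euclidean_product_topology[symmetric]
  by (simp add: limitin_componentwise)

text \<open>
  Pointwise convergence ignores the tail. Cutting \<open>q\<close> off at \<open>j\<close> and placing the missing mass
  \<open>1 - (\<Sum>i<j. q i)\<close> at \<open>j\<close> gives approximations of sum exactly \<open>1\<close>; scaling \<open>q\<close> by a factor slightly
  below \<open>1\<close> gives approximations of sum less than \<open>1\<close>.
\<close>

lemma subprob_sequences_dense_both:
  assumes U: "open U" and q: "q \<in> subprob_sequences \<inter> U"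
  obtains r where "r \<in> subprob_sequences \<inter> U" "(suminf r = 1) \<longleftrightarrow> b"
proof -
  have pointwise: "\<exists>j. r j \<in> U" if "\<And>k. (\<lambda>j. r j k) \<longlonglongrightarrow> q k" for r :: "nat \<Rightarrow> nat \<Rightarrow> real"
  proof -
    have "r \<longlonglongrightarrow> q" using that by (simp add: tendsto_fun_iff_pointwise)
    then have "\<forall>\<^sub>F j in sequentially. r j \<in> U" using U q topological_tendstoD by blast
    then show ?thesis by (meson eventually_sequentially order_refl)
  qed
  have q0: "0 \<le> q k" and q1: "(\<Sum>k<n. q k) \<le> 1" for k n
    using q by (auto simp: subprob_sequences_def)
  show thesis
  proof (cases b)
    case True
    define r where "r j k = (if k < j then q k else if k = j then 1 - (\<Sum>i<j. q i) else 0)" for j k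
    have "\<exists>j. r j \<in> U"
    proof (rule pointwise)
      fix k
      show "(\<lambda>j. r j k) \<longlonglongrightarrow> q k"
        by (rule tendsto_eventually, rule eventually_sequentiallyI[of "Suc k"]) (simp add: r_def)
    qed
    then obtain j where j: "r j \<in> U" by blast
    have sums: "(\<Sum>k<Suc j. r j k) = 1" by (simp add: r_def)
    have r0: "0 \<le> r j k" for k using q0 q1 by (simp add: r_def)
    have "(\<lambda>k. r j k) sums (\<Sum>k<Suc j. r j k)"
      by (rule sums_finite) (auto simp: r_def)
    then have s: "r j sums 1" using sums by simp
    have "(\<Sum>k<n. r j k) \<le> 1" for n
      using sum_le_suminf[OF sums_summable[OF s], of "{..<n}"] r0 sums_unique[OF s] by simp
    then have "r j \<in> subprob_sequences" using r0 by (simp add: subprob_sequences_def)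
    then show thesis using that j s True sums_unique by fastforce
  next
    case False
    define c where "c j = 1 - 1 / real (Suc j)" for j
    have c: "0 \<le> c j" "c j < 1" for j by (auto simp: c_def field_simps)
    have "c \<longlonglongrightarrow> 1 - 0"
      unfolding c_def using LIMSEQ_inverse_real_of_nat
      by (intro tendsto_diff tendsto_const) (simp add: inverse_eq_divide)
    then have "\<exists>j. (\<lambda>k. c j * q k) \<in> U"
      by (intro pointwise) (auto intro!: tendsto_eq_intros)
    then obtain j where j: "(\<lambda>k. c j * q k) \<in> U" by blast
    have "(\<Sum>k<n. c j * q k) \<le> c j" for n
      using mult_left_mono[OF q1[of n] c(1)[of j]] by (simp add: sum_distrib_left)
    moreover from this have "(\<Sum>k<n. c j * q k) \<le> 1" for n using c(2)[of j] by (meson less_imp_le order_trans)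
    then have mem: "(\<lambda>k. c j * q k) \<in> subprob_sequences"
      using c q0 by (simp add: subprob_sequences_def)
    ultimately have "(\<Sum>k. c j * q k) \<le> c j"
      by (intro suminf_le_const summable_subprob_sequences) auto
    then have "(\<Sum>k. c j * q k) \<noteq> 1" using c(2)[of j] by linarith
    then show thesis using that[of "\<lambda>k. c j * q k"] j mem False by simp
  qed
qed

section \<open>Failure of prediction\<close>

text \<open>
  The reverse Fatou inequality for events: the event that infinitely many \<open>A j\<close> occur is a decreasing
  limit of unions, each containing some \<open>A j\<close>.
\<close>

lemma (in finite_measure) measure_frequently_ge:
  assumes A: "\<And>j. A j \<in> sets M" "\<And>j. c \<le> measure M (A j)"
  shows "c \<le> measure M (\<Inter>J::nat. \<Union>j\<in>{J..}. A j)"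
proof -
  have "(\<lambda>J. measure M (\<Union>j\<in>{J..}. A j)) \<longlonglongrightarrow> measure M (\<Inter>J. \<Union>j\<in>{J..}. A j)"
    using A(1) by (intro finite_Lim_measure_decseq) (auto simp: decseq_def, force)
  moreover have "c \<le> measure M (\<Union>j\<in>{J..}. A j)" for J
    using A(2)[of J] finite_measure_mono[of "A J" "\<Union>j\<in>{J..}. A j"] A(1) by fastforce
  ultimately show ?thesis by (intro Lim_bounded2[of _ _ 0]) auto
qed

text \<open>
  All laws of the family are realized on one probability space, by applying \<open>spike_sum q\<close> to the same
  sequence of independent uniform variables. On this space the guesses made for different parameters
  can be compared point by point, which gives the closedness needed for Baire's theorem. The samples
  may be transported by any Borel map \<open>J\<close>, since the argument uses only equality of samples.
\<close>

lemma not_eventually_as_predictable_spike_laws: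
  fixes J :: "real \<Rightarrow> 'x::topological_space"
  assumes J [measurable]: "J \<in> borel_measurable borel"
  defines "law \<equiv> \<lambda>q. distr (\<Pi>\<^sub>M i\<in>(UNIV :: nat set). unit_uniform) (\<Pi>\<^sub>M i\<in>UNIV. borel)
                       (\<lambda>\<omega> i. J (spike_sum q (\<omega> i)))"
  assumes Q: "\<And>q. q \<in> subprob_sequences \<Longrightarrow> Q (law q) \<longleftrightarrow> suminf q \<noteq> 1"
  shows "\<not> eventually_as_predictable (law ` subprob_sequences) Q"
proof
  assume "eventually_as_predictable (law ` subprob_sequences) Q"
  then obtain \<Phi> :: "nat \<Rightarrow> (nat \<Rightarrow> 'x) \<Rightarrow> nat"
    where \<Phi>: "\<And>N. N \<ge> 1 \<Longrightarrow> \<Phi> N \<in> measurable (\<Pi>\<^sub>M i\<in>{..<N}. borel) (count_space {0, 1})"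
    and pred: "\<And>q. q \<in> subprob_sequences \<Longrightarrow>
        \<P>(\<omega> in law q. \<forall>\<^sub>F N in sequentially. \<Phi> N (restrict \<omega> {..<N}) = of_bool (Q (law q))) = 1"
    unfolding eventually_as_predictable_def by blast
  let ?W = "\<Pi>\<^sub>M i\<in>(UNIV :: nat set). unit_uniform"
  interpret U: prob_space unit_uniform by (rule prob_space_unit_uniform)
  interpret product_prob_space "\<lambda>_. unit_uniform" "UNIV :: nat set" ..
  define guess where "guess q \<omega> n = \<Phi> n (\<lambda>i\<in>{..<n}. J (spike_sum q (\<omega> i)))" for q \<omega> n
  have guess [measurable]: "(\<lambda>\<omega>. guess q \<omega> n) \<in> measurable ?W (count_space UNIV)" if "n \<ge> 1" for q n
  proof -
    have "(\<lambda>\<omega>. \<lambda>i\<in>{..<n}. J (spike_sum q (\<omega> i))) \<in> measurable ?W (\<Pi>\<^sub>M i\<in>{..<n}. borel)"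
      by measurable
    from measurable_compose[OF this \<Phi>[OF that]] show ?thesis
      unfolding guess_def
      by (rule measurable_compose[where N = "count_space {0, 1}"]) simp
  qed
  \<comment> \<open>Strictly after \<open>N\<close>: the predictor is measurable only at times \<open>n \<ge> 1\<close>.\<close>
  define always where "always q b N = {\<omega>\<in>space ?W. \<forall>n\<in>{Suc N..}. guess q \<omega> n = of_bool b}" for q b N
  have always [measurable]: "always q b N \<in> sets ?W" for q b N
  proof -
    have "{\<omega>\<in>space ?W. n \<in> {Suc N..} \<longrightarrow> guess q \<omega> n = of_bool b} \<in> sets ?W" for n
    proof (cases "n \<in> {Suc N..}")
      case True
      have "{\<omega>\<in>space ?W. n \<in> {Suc N..} \<longrightarrow> guess q \<omega> n = of_bool b}
          = (\<lambda>\<omega>. guess q \<omega> n) -` {of_bool b} \<inter> space ?W"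
        using True by blast
      then show ?thesis using measurable_sets[OF guess[of n q]] True by simp
    qed simp
    then show ?thesis unfolding always_def Ball_def by (rule sets.sets_Collect_countable_All)
  qed
  have eventually_right: "AE \<omega> in ?W. \<exists>N. \<omega> \<in> always q (suminf q \<noteq> 1) N"
    if q: "q \<in> subprob_sequences" for q
  proof -
    have map: "(\<lambda>\<omega> i. J (spike_sum q (\<omega> i))) \<in> measurable ?W (\<Pi>\<^sub>M i\<in>(UNIV :: nat set). borel)"
      by (rule measurable_PiM_single') auto
    interpret L: prob_space "law q" unfolding law_def by (rule P.prob_space_distr[OF map])
    \<comment> \<open>A set of measure \<open>1\<close> is measurable, because \<open>measure\<close> is \<open>0\<close> outside the sigma-algebra.\<close>
    have "AE \<omega> in law q. \<forall>\<^sub>F N in sequentially. \<Phi> N (restrict \<omega> {..<N}) = of_bool (Q (law q))"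
      using L.AE_prob_1[OF pred[OF q]] by eventually_elim simp
    then have "AE \<omega> in ?W. \<forall>\<^sub>F n in sequentially. guess q \<omega> n = of_bool (suminf q \<noteq> 1)"
      unfolding Q[OF q] unfolding law_def guess_def by (rule AE_distrD[OF map])
    with AE_space show ?thesis
    proof eventually_elim
      case (elim \<omega>)
      then obtain N where "\<And>n. n \<ge> N \<Longrightarrow> guess q \<omega> n = of_bool (suminf q \<noteq> 1)"
        unfolding eventually_sequentially by blast
      then have "\<omega> \<in> always q (suminf q \<noteq> 1) N"
        unfolding always_def using elim(1) by (simp del: of_bool_eq_iff)
      then show ?case by blast
    qed
  qed
  define F where "F = (\<lambda>(b, N). {q\<in>subprob_sequences. 1 / 2 \<le> measure ?W (always q b N)})"
  \<comment> \<open>Along a convergent sequence of parameters, infinitely many of the events \<open>always (r j) b N\<close> occur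
    with probability at least \<open>1/2\<close>. Almost surely each guess for \<open>q\<close>, being a function of finitely
    many samples, agrees with the guess for \<open>r j\<close> once \<open>j\<close> is large, so \<open>always q b N\<close> occurs too.\<close>
  have "closed (F (b, N))" for b N
    unfolding closed_sequential_limits
  proof safe
    fix r q assume r: "\<forall>j. r j \<in> F (b, N)" and lim: "r \<longlonglongrightarrow> q"
    then have rS: "\<And>j. r j \<in> subprob_sequences" and half: "\<And>j. 1 / 2 \<le> measure ?W (always (r j) b N)"
      by (auto simp: F_def)
    have q: "q \<in> subprob_sequences"
      using closed_subprob_sequences rS lim closed_sequentially by blast
    have limk: "(\<lambda>j. r j k) \<longlonglongrightarrow> q k" for k
      using lim by (simp add: tendsto_fun_iff_pointwise)
    have "AE \<omega> in ?W. \<forall>i. 0 < \<omega> i \<and> (\<forall>k. \<omega> i \<noteq> q k / real (Suc k))"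
      by (simp only: AE_all_countable AE_conj_iff)
         (auto intro!: AE_component AE_unit_uniform_pos AE_unit_uniform_neq)
    then have ev: "AE \<omega> in ?W. \<forall>i. \<forall>\<^sub>F j in sequentially. spike_sum (r j) (\<omega> i) = spike_sum q (\<omega> i)"
      by eventually_elim (auto intro!: spike_sum_eventually_const[OF q rS limk])
    have "1 / 2 \<le> measure ?W (\<Inter>M. \<Union>j\<in>{M..}. always (r j) b N)"
      by (rule P.measure_frequently_ge) (use half in auto)
    also have "\<dots> \<le> measure ?W (always q b N)"
    proof (rule P.finite_measure_mono_AE)
      show "AE \<omega> in ?W. \<omega> \<in> (\<Inter>M. \<Union>j\<in>{M..}. always (r j) b N) \<longrightarrow> \<omega> \<in> always q b N"
        using ev
      proof eventually_elim
        case (elim \<omega>)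
        show ?case
        proof
          assume io: "\<omega> \<in> (\<Inter>M. \<Union>j\<in>{M..}. always (r j) b N)"
          have "guess q \<omega> n = of_bool b" if n: "n \<in> {Suc N..}" for n
          proof -
            have "\<forall>\<^sub>F j in sequentially. \<forall>i\<in>{..<n}. spike_sum (r j) (\<omega> i) = spike_sum q (\<omega> i)"
              using elim by (intro eventually_ball_finite) auto
            then obtain M where M: "\<And>j i. j \<ge> M \<Longrightarrow> i < n \<Longrightarrow> spike_sum (r j) (\<omega> i) = spike_sum q (\<omega> i)"
              unfolding eventually_sequentially by blast
            obtain j where j: "j \<ge> M" "\<omega> \<in> always (r j) b N" using io by blast
            have "(\<lambda>i\<in>{..<n}. J (spike_sum (r j) (\<omega> i))) = (\<lambda>i\<in>{..<n}. J (spike_sum q (\<omega> i)))"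
              using M[OF j(1)] by (intro restrict_ext) simp
            then have "guess q \<omega> n = guess (r j) \<omega> n" by (simp add: guess_def)
            also have "\<dots> = of_bool b" using j(2) n unfolding always_def by blast
            finally show ?thesis .
          qed
          moreover have "\<omega> \<in> space ?W" using io by (auto simp: always_def)
          ultimately show "\<omega> \<in> always q b N" by (auto simp: always_def)
        qed
      qed
    qed simp
    finally show "q \<in> F (b, N)" using q by (simp add: F_def)
  qed
  moreover have "subprob_sequences \<subseteq> (\<Union>i\<in>UNIV. F i)"
  proof
    fix q assume q: "q \<in> subprob_sequences"
    let ?b = "suminf q \<noteq> 1"
    have "(\<lambda>N. measure ?W (always q ?b N)) \<longlonglongrightarrow> measure ?W (\<Union>N. always q ?b N)"
      by (rule P.finite_Lim_measure_incseq) (auto simp: incseq_def always_def)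
    also have "measure ?W (\<Union>N. always q ?b N) = 1"
      using eventually_right[OF q] by (subst P.prob_eq_1) auto
    finally have "\<forall>\<^sub>F N in sequentially. 1 / 2 < measure ?W (always q ?b N)"
      by (rule order_tendstoD) simp
    then obtain N where "1 / 2 < measure ?W (always q ?b N)"
      unfolding eventually_sequentially by blast
    then have "q \<in> F (?b, N)" using q by (simp add: F_def)
    then show "q \<in> (\<Union>i\<in>UNIV. F i)" by blast
  qed
  moreover have "(\<lambda>_. 0) \<in> subprob_sequences" by (simp add: subprob_sequences_def)
  ultimately obtain b N V where V: "open V" "subprob_sequences \<inter> V \<noteq> {}"
    "subprob_sequences \<inter> V \<subseteq> F (b, N)"
    by (metis (no_types, lifting) Baire_countable_closed_cover[OF closed_subprob_sequences, of UNIV F] countableI_type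
        empty_iff surj_pair)
  then obtain r where r: "r \<in> subprob_sequences \<inter> V" "suminf r = 1 \<longleftrightarrow> b"
    using subprob_sequences_dense_both[of V _ b] by blast
  have "AE \<omega> in ?W. \<omega> \<notin> always r b N"
    using eventually_right[OF IntD1[OF r(1)]]
  proof eventually_elim
    case (elim \<omega>)
    then obtain N' where N': "\<omega> \<in> always r (\<not> b) N'" using r by auto
    show ?case
    proof
      assume N: "\<omega> \<in> always r b N"
      have "guess r \<omega> (Suc (max N N')) = of_bool b" using N by (simp add: always_def)
      moreover have "guess r \<omega> (Suc (max N N')) = of_bool (\<not> b)" using N' by (simp add: always_def)
      ultimately show False by (cases b) simp_all
    qed
  qed
  then have "measure ?W (always r b N) = 0"
    by (subst P.prob_eq_0) auto
  moreover have "1 / 2 \<le> measure ?W (always r b N)" using V(3) r(1) by (auto simp: F_def)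
  ultimately show False by simp
qed

lemma continuous_corner_matrix: "continuous_on UNIV (corner_matrix a b :: real \<Rightarrow> real^'n::finite^'n)"
proof -
  have "continuous_on UNIV (\<lambda>t :: real. if j = b then (if i = a then 1 else if i = b then t else 0) else 0)"
    for i j by (cases "j = b"; cases "i = a"; cases "i = b") (simp_all add: continuous_on_id)
  then show ?thesis unfolding corner_matrix_def by (intro continuous_on_vec_lambda)
qed

lemma eventually_as_predictable_mono:
  "eventually_as_predictable L Q \<Longrightarrow> K \<subseteq> L \<Longrightarrow> eventually_as_predictable K Q"
  unfolding eventually_as_predictable_def by blast

theorem corollary5p2:
  fixes D :: "(real ^'n::finite^'n) set"
  assumes "CARD('n) \<ge> 2"
    and "D \<in> {diagonalizable_over TYPE(real), diagonalizable_over TYPE(complex)}"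
  shows "\<not> eventually_as_predictable
           (integrable_iid_laws :: (nat \<Rightarrow> real ^'n^'n) measure set) (\<lambda>M. mean_matrix M \<in> D)"
proof -
  obtain a b :: 'n where ab: "a \<noteq> b"
    using assms(1) by (metis card_2_iff' ex_card UNIV_I)
  let ?J = "\<lambda>t. corner_matrix a b (1 - t) :: real^'n^'n"
  let ?law = "\<lambda>q. distr (\<Pi>\<^sub>M i\<in>(UNIV :: nat set). unit_uniform) (\<Pi>\<^sub>M i\<in>UNIV. borel)
                    (\<lambda>\<omega> i. ?J (spike_sum q (\<omega> i)))"
  interpret U: prob_space unit_uniform by (rule prob_space_unit_uniform)
  have J [measurable]: "?J \<in> borel_measurable borel"
    by (intro borel_measurable_continuous_onI continuous_on_compose2[OF continuous_corner_matrix]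
        continuous_intros) auto
  have Y [measurable]: "(\<lambda>u. ?J (spike_sum q u)) \<in> borel_measurable unit_uniform" for q
    by measurable
  have entry: "integrable unit_uniform (\<lambda>u. ?J (spike_sum q u) $ i $ j)"
    "(\<integral>u. ?J (spike_sum q u) $ i $ j \<partial>unit_uniform) = ?J (suminf q) $ i $ j"
    if "q \<in> subprob_sequences" for q i j
    using expectation_spike_sum[OF that] U.prob_space
    by (cases "i = a"; cases "i = b"; cases "j = b"; use ab in \<open>simp add: corner_matrix_def\<close>)+
  have coord: "distr (?law q) borel (\<lambda>\<omega>. \<omega> 0) = distr unit_uniform borel (\<lambda>u. ?J (spike_sum q u))" for q
    by (rule iid_laws_distr_PiM(2)[OF prob_space_unit_uniform Y])
  have proj [measurable]: "(\<lambda>\<omega>. \<omega> 0) \<in> measurable (?law q) borel" for q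
    by simp
  have nth [measurable]: "(\<lambda>x. x $ i $ j) \<in> borel_measurable (borel :: (real^'n^'n) measure)" for i j
    by (intro borel_measurable_continuous_onI continuous_intros)
  have mean: "mean_matrix (?law q) = ?J (suminf q)" if q: "q \<in> subprob_sequences" for q
  proof -
    have "(\<integral>\<omega>. \<omega> 0 $ i $ j \<partial>?law q) = ?J (suminf q) $ i $ j" for i j
    proof -
      have "(\<integral>\<omega>. \<omega> 0 $ i $ j \<partial>?law q) = (\<integral>x. x $ i $ j \<partial>distr (?law q) borel (\<lambda>\<omega>. \<omega> 0))"
        by (subst integral_distr[OF proj]) auto
      also have "\<dots> = ?J (suminf q) $ i $ j"
        unfolding coord by (subst integral_distr[OF Y]) (auto simp: entry[OF q])
      finally show ?thesis .
    qed
    then show ?thesis by (simp add: mean_matrix_def vec_eq_iff)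
  qed
  have "?law q \<in> integrable_iid_laws" if q: "q \<in> subprob_sequences" for q
  proof -
    have "integrable unit_uniform (\<lambda>u. norm (?J (spike_sum q u)))"
    proof (rule Bochner_Integration.integrable_bound)
      show "integrable unit_uniform (\<lambda>u. \<Sum>i\<in>UNIV. \<Sum>j\<in>UNIV. \<bar>?J (spike_sum q u) $ i $ j\<bar>)"
        by (intro Bochner_Integration.integrable_sum integrable_abs entry[OF q])
      show "AE u in unit_uniform. norm (norm (?J (spike_sum q u)))
          \<le> norm (\<Sum>i\<in>UNIV. \<Sum>j\<in>UNIV. \<bar>?J (spike_sum q u) $ i $ j\<bar>)"
      proof (rule AE_I2)
        fix u
        have "norm (?J (spike_sum q u)) \<le> (\<Sum>i\<in>UNIV. norm (?J (spike_sum q u) $ i))"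
          by (simp add: norm_vec_def L2_set_le_sum)
        also have "\<dots> \<le> (\<Sum>i\<in>UNIV. \<Sum>j\<in>UNIV. \<bar>?J (spike_sum q u) $ i $ j\<bar>)"
          by (intro sum_mono norm_le_l1_cart)
        finally show "norm (norm (?J (spike_sum q u)))
          \<le> norm (\<Sum>i\<in>UNIV. \<Sum>j\<in>UNIV. \<bar>?J (spike_sum q u) $ i $ j\<bar>)" by simp
      qed
    qed measurable
    then have "integrable (distr (?law q) borel (\<lambda>\<omega>. \<omega> 0)) norm"
      unfolding coord by (subst integrable_distr_eq[OF Y]) auto
    then have "integrable (?law q) (\<lambda>\<omega>. norm (\<omega> 0))"
      by (subst (asm) integrable_distr_eq[OF proj]) auto
    then show ?thesis
      unfolding integrable_iid_laws_def
      using iid_laws_distr_PiM(1)[OF prob_space_unit_uniform Y] by simp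
  qed
  then have "?law ` subprob_sequences \<subseteq> integrable_iid_laws" by blast
  moreover have "\<not> eventually_as_predictable (?law ` subprob_sequences) (\<lambda>M. mean_matrix M \<in> D)"
  proof (rule not_eventually_as_predictable_spike_laws[OF J])
    fix q assume "q \<in> subprob_sequences"
    then show "mean_matrix (?law q) \<in> D \<longleftrightarrow> suminf q \<noteq> 1"
      using assms(2) by (auto simp: mean diagonalizable_corner_matrix_iff[OF ab])
  qed
  ultimately show ?thesis using eventually_as_predictable_mono by blast
qed

end
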